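(* Let $\Gamma$ be a Polish group, and let $\mu$ be a Borel probability measure on $\Gamma$. Let $S\subseteq\Gamma$ be a countably infinite subset. Then the Schreier graph $\mathrm{Sch}(\Gamma,S,\Gamma)$ admits a $\mu$-measurable domatic $\aleph_0$-partition.
   Context: The Schreier graph $\mathrm{Sch}(\Gamma,S,\Gamma)$ is the directed graph (loops allowed) with vertex set $\Gamma$ and edge set $\{(\gamma,s\gamma):\gamma\in\Gamma,\ s\in S\}$, so the out-neighborhood of $\gamma$ is $S\cdot\gamma=\{s\gamma:s\in S\}$. A $\mu$-measurable domatic $\aleph_0$-partition of this graph is a sequence $\langle D_j:j\in\mathbb{N}\rangle$ of pairwise-disjoint $\mu$-measurable subsets of $\Gamma$ (measurable with respect to the completion of $\mu$) such that $(S\cdot\gamma)\cap D_j\neq\varnothing$ for every (not merely $\mu$-almost every) $\gamma\in\Gamma$ and every $j\in\mathbb{N}$. *)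

theory Defs
  imports "HOL-Probability.Probability"
begin

text \<open>
  Groups are written additively, following the library's class of topological groups. Neither
  \<^class>\<open>group_add\<close> nor \<^class>\<open>topological_group_add\<close> assumes commutativity, so the group product
  $s\gamma$ is \<open>s + \<gamma>\<close>, in this order. A Polish group is a type of sort
  \<open>{polish_space, topological_group_add}\<close>: the metric of \<^class>\<open>polish_space\<close> is only required to be
  complete and compatible with the topology, not to be invariant.
\<close>

text \<open>A directed graph, loops allowed, is given by its edge relation; all of \<open>UNIV\<close> is the vertex
  set, and the out-neighbourhood of \<open>\<gamma>\<close> in \<open>E\<close> is \<open>E `` {\<gamma>}\<close>.\<close>

definition schreier_graph :: "'a::group_add set \<Rightarrow> ('a \<times> 'a) set" where
  "schreier_graph S = {(\<gamma>, s + \<gamma>) | \<gamma> s. s \<in> S}"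

lemma schreier_graph_out_neighbourhood:
  "schreier_graph S `` {\<gamma>} = (\<lambda>s. s + \<gamma>) ` S"
  by (auto simp: schreier_graph_def)

text \<open>As in the source, the classes are disjoint but need not cover the vertex set, and the domination
  condition is imposed at every vertex rather than almost everywhere.\<close>

definition measurable_domatic_partition ::
    "'a measure \<Rightarrow> ('a \<times> 'a) set \<Rightarrow> (nat \<Rightarrow> 'a set) \<Rightarrow> bool" where
  "measurable_domatic_partition \<mu> E D \<longleftrightarrow>
     (\<forall>j. D j \<in> sets (completion \<mu>)) \<and>
     disjoint_family D \<and>
     (\<forall>\<gamma> j. E `` {\<gamma>} \<inter> D j \<noteq> {})"

end

theory Submission
  imports Defs
begin

text \<open>
  Given disjoint Borel sets \<open>D j\<close>, call \<open>x\<close> bad if some \<open>D j\<close> meets \<open>S + x\<close> in only finitely many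
  points. If a null set \<open>A\<close> contains \<open>S + x\<close> for all bad \<open>x\<close>, then the classes can be repaired by
  changing them on \<open>A\<close>: a point \<open>x\<close> with \<open>(S + x) \<inter> A\<close> finite is not bad and still sees every
  \<open>D j - A\<close>, and for the remaining points the axiom of choice colours \<open>A\<close> on each of the countable
  components of the graph.

  The set of bad points has to be null for all translates of \<open>\<mu>\<close> by inverses of elements of \<open>S\<close>. The
  sets \<open>D j\<close> come from a sequence of Borel sets \<open>A m\<close>, each of which meets \<open>{s n + x | n < N (m + 1)}\<close>
  for most \<open>x\<close> but misses \<open>{s n + x | n < N m}\<close> for most \<open>x\<close>. A point gets the colour of the last
  \<open>A m\<close> containing it; by Borel--Cantelli almost every \<open>x\<close> then sees every colour infinitely often.
\<close>

section \<open>Finite covers and Borel hitting sets\<close>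

text \<open>A maximal \<open>J\<close> with the first property works: no further \<open>i\<close> can be added, so \<open>H i\<close> outside the
  union has measure at most \<open>w i\<close>, and the points of \<open>G\<close> outside the union are counted \<open>T\<close> times.\<close>

lemma (in prob_space) greedy_cover:
  fixes H :: "'i \<Rightarrow> 'a set" and w :: "'i \<Rightarrow> real"
  assumes fin: "finite I"
    and H: "\<And>i. i \<in> I \<Longrightarrow> H i \<in> events"
    and w: "\<And>i. i \<in> I \<Longrightarrow> w i \<ge> 0"
    and G: "G \<in> events"
    and card: "\<And>x. x \<in> G \<Longrightarrow> T \<le> card {i \<in> I. x \<in> H i}"
  shows "\<exists>J\<subseteq>I. sum w J \<le> prob (\<Union>i\<in>J. H i) \<and> real T * prob (G - (\<Union>i\<in>J. H i)) \<le> sum w I"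
proof -
  define F where "F = {J. J \<subseteq> I \<and> sum w J \<le> prob (\<Union>i\<in>J. H i)}"
  have "finite F" using fin by (simp add: F_def)
  moreover have "{} \<in> F" by (simp add: F_def)
  ultimately obtain J where J: "J \<in> F" and J_max: "\<And>J'. J' \<in> F \<Longrightarrow> J \<subseteq> J' \<Longrightarrow> J' = J"
    using finite_has_maximal[of F] by (metis empty_iff)
  define U where "U = (\<Union>i\<in>J. H i)"
  have JI: "J \<subseteq> I" and Jw: "sum w J \<le> prob U" using J by (auto simp: F_def U_def)
  have finJ: "finite J" using JI fin finite_subset by blast
  have U[measurable]: "U \<in> events" unfolding U_def using finJ JI H by blast
  note G[measurable]
  have small: "prob (H i - U) \<le> w i" if i: "i \<in> I" for i
  proof (cases "i \<in> J")
    case True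
    then have empty: "H i - U = {}" by (auto simp: U_def)
    show ?thesis unfolding empty using w[OF i] by simp
  next
    case False
    then have "insert i J \<notin> F" using J_max by blast
    then have "prob (H i \<union> U) < w i + sum w J"
      using False finJ JI i by (auto simp: F_def U_def not_le)
    moreover have "prob (H i \<union> U) = prob U + prob (H i - U)"
      using finite_measure_Union'[OF U H[OF i]] by (simp add: Un_commute)
    ultimately show ?thesis using Jw by linarith
  qed
  have "real T * prob (G - U) = (\<integral>x. real T * indicator (G - U) x \<partial>M)"
    by simp
  also have "\<dots> \<le> (\<integral>x. (\<Sum>i\<in>I. indicator (H i - U) x) \<partial>M)"
  proof (rule integral_mono)
    show "integrable M (\<lambda>x. real T * indicator (G - U) x)"
      by (intro integrable_mult_right integrable_real_indicator) (auto simp: emeasure_eq_measure)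
    show "integrable M (\<lambda>x. \<Sum>i\<in>I. indicator (H i - U) x :: real)"
      using H by (intro Bochner_Integration.integrable_sum integrable_real_indicator) (auto simp: emeasure_eq_measure)
    fix x
    have "(\<Sum>i\<in>I. indicator (H i - U) x :: real) = card {i \<in> I. x \<in> H i}" if "x \<notin> U"
      using that fin by (simp add: indicator_def sum.If_cases Int_def flip: sum.inter_filter)
    then show "real T * indicator (G - U) x \<le> (\<Sum>i\<in>I. indicator (H i - U) x)"
      using card[of x] by (auto simp: indicator_def sum_nonneg)
  qed
  also have "\<dots> = (\<Sum>i\<in>I. prob (H i - U))"
    using H by (subst Bochner_Integration.integral_sum) (auto simp: emeasure_eq_measure intro!: sum.cong)
  also have "\<dots> \<le> sum w I" by (rule sum_mono) (rule small)
  finally show ?thesis using JI Jw by (auto simp: U_def)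
qed

lemma separating_open_sequence:
  obtains U :: "nat \<Rightarrow> 'b::{second_countable_topology,t1_space} set"
  where "\<And>k. open (U k)" "\<And>x y. x \<noteq> y \<Longrightarrow> \<exists>k. x \<in> U k \<longleftrightarrow> y \<notin> U k"
proof -
  obtain B :: "'b set set" where B: "countable B" "topological_basis B"
    using ex_countable_basis by blast
  show thesis
  proof
    \<comment> \<open>Adding the empty set makes the basis nonempty, as its enumeration
      requires.\<close>
    have r: "range (from_nat_into (insert {} B)) = insert {} B"
      using B by (simp add: range_from_nat_into)
    show "open (from_nat_into (insert {} B) k)" for k
      using r B(2) topological_basis_open[OF B(2)] by (metis insert_iff open_empty rangeI)
    fix x y :: 'b assume "x \<noteq> y"
    then obtain V where "open V" "x \<in> V" "y \<notin> V" using t1_space by blast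
    then obtain W where "W \<in> B" "x \<in> W" "W \<subseteq> V" using topological_basisE[OF B(2)] by metis
    then have "W \<in> range (from_nat_into (insert {} B))" "x \<in> W" "y \<notin> W"
      using r \<open>y \<notin> V\<close> by auto
    then show "\<exists>k. (x \<in> from_nat_into (insert {} B) k) = (y \<notin> from_nat_into (insert {} B) k)" by blast
  qed
qed

text \<open>Cut the target space into finitely many pieces, each weighted by the expected number of
  its visits at times \<open>n < N\<close>, divided by \<open>e\<close>. The total weight is
  \<open>N / e\<close>, while most \<open>x\<close> visit \<open>T\<close> different pieces before
  time \<open>T\<close>; \<open>greedy_cover\<close> then selects pieces of total weight at most 1
  that only few \<open>x\<close> avoid.\<close>

lemma (in prob_space) small_hitting_set:
  fixes g :: "nat \<Rightarrow> 'a \<Rightarrow> 'b::{second_countable_topology, t1_space}"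
  assumes g[measurable]: "\<And>n. g n \<in> borel_measurable M"
    and inj: "\<And>x. x \<in> space M \<Longrightarrow> inj (\<lambda>n. g n x)"
    and e: "e > 0"
  shows "\<exists>A\<in>sets borel. \<exists>T\<ge>N. (\<Sum>n<N. prob {x \<in> space M. g n x \<in> A}) \<le> e \<and>
    prob {x \<in> space M. \<forall>n<T. g n x \<notin> A} \<le> e"
proof -
  obtain U :: "nat \<Rightarrow> 'b set" where U: "\<And>k. open (U k)"
    and sep: "\<And>x y. x \<noteq> y \<Longrightarrow> \<exists>k. x \<in> U k \<longleftrightarrow> y \<notin> U k"
    using separating_open_sequence by blast
  have [measurable]: "U k \<in> sets borel" for k using U by simp
  \<comment> \<open>The second bound makes the loss \<open>N / (e T)\<close> at most
    \<open>e / 2\<close>; \<open>Suc N\<close> keeps \<open>T\<close> positive and at least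
    \<open>N\<close>.\<close>
  define T where "T = max (Suc N) (nat \<lceil>2 * real N / e\<^sup>2\<rceil>)"
  have T: "N \<le> T" "0 < T" "2 * real N / e\<^sup>2 \<le> real T" unfolding T_def by linarith+
  \<comment> \<open>On \<open>G k\<close> the first \<open>k\<close> open sets tell the first
    \<open>T\<close> points apart; these events increase to the whole space by injectivity.\<close>
  define G where "G k = {x \<in> space M. \<forall>m<T. \<forall>n<T. m \<noteq> n \<longrightarrow> (\<exists>l<k. g m x \<in> U l \<longleftrightarrow> g n x \<notin> U l)}" for k :: nat
  have G[measurable]: "G k \<in> events" for k unfolding G_def by measurable
  have "incseq G" unfolding incseq_def G_def by (auto; meson order_less_le_trans)
  then have "(\<lambda>k. prob (G k)) \<longlonglongrightarrow> prob (\<Union>k. G k)"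
    by (intro finite_Lim_measure_incseq) auto
  moreover have "(\<Union>k. G k) = space M"
  proof (intro antisym subsetI)
    fix x assume x: "x \<in> space M"
    have "\<exists>l. m \<noteq> n \<longrightarrow> (g m x \<in> U l \<longleftrightarrow> g n x \<notin> U l)" for m n
      using sep[of "g m x" "g n x"] inj[OF x] by (auto simp: inj_def)
    then obtain l where l: "\<And>m n. m \<noteq> n \<Longrightarrow> (g m x \<in> U (l m n) \<longleftrightarrow> g n x \<notin> U (l m n))" by metis
    define L where "L = (\<lambda>(m, n). l m n) ` ({..<T} \<times> {..<T})"
    have "l m n < Suc (Max L)" if "m < T" "n < T" for m n
      using that by (intro le_imp_less_Suc Max_ge) (auto simp: L_def)
    then have "x \<in> G (Suc (Max L))" using x l unfolding G_def by blast
    then show "x \<in> (\<Union>k. G k)" by blast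
  qed (auto simp: G_def)
  ultimately have "(\<lambda>k. prob (G k)) \<longlonglongrightarrow> 1" by (simp add: prob_space)
  then have "eventually (\<lambda>k. prob (G k) > 1 - e / 2) sequentially"
    using e by (intro order_tendstoD(1)) auto
  then obtain k where k: "prob (G k) > 1 - e / 2" by (auto simp: eventually_sequentially)

  txt \<open>The pieces \<open>B i\<close> are fine enough that the first \<open>T\<close> points over each \<open>x \<in> G k\<close> lie in different
    pieces, and \<open>A\<close> will be a union of pieces.\<close>
  define B where "B i = {y. \<forall>l<k. y \<in> U l \<longleftrightarrow> l \<in> i}" for i
  define code where "code y = {l. l < k \<and> y \<in> U l}" for y
  have B[measurable]: "B i \<in> sets borel" for i unfolding B_def by measurable
  have code_B: "y \<in> B (code y)" for y by (simp add: B_def code_def)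
  have B_iff: "y \<in> B i \<longleftrightarrow> code y = i" if "i \<subseteq> {..<k}" for i y
    using that by (auto simp: B_def code_def)
  define I where "I = Pow {..<k}"
  have B_inj: "i = i'" if "i \<in> I" "i' \<in> I" "y \<in> B i" "y \<in> B i'" for i i' y
    using that B_iff[of i y] B_iff[of i' y] by (simp add: I_def)
  have finI: "finite I" by (simp add: I_def)
  have code_I: "code y \<in> I" for y by (auto simp: code_def I_def)
  define H where "H i = {x \<in> space M. \<exists>n<T. g n x \<in> B i}" for i
  define w where "w i = (\<Sum>n<N. prob {x \<in> space M. g n x \<in> B i}) / e" for i
  have sum_w: "sum w J = (\<Sum>n<N. prob {x \<in> space M. g n x \<in> (\<Union>i\<in>J. B i)}) / e" if J: "J \<subseteq> I" for J
  proof -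
    have "(\<Sum>i\<in>J. prob {x \<in> space M. g n x \<in> B i}) = prob {x \<in> space M. g n x \<in> (\<Union>i\<in>J. B i)}" for n
    proof -
      have "prob (\<Union>i\<in>J. {x \<in> space M. g n x \<in> B i}) = (\<Sum>i\<in>J. prob {x \<in> space M. g n x \<in> B i})"
      proof (rule finite_measure_finite_Union)
        show "disjoint_family_on (\<lambda>i. {x \<in> space M. g n x \<in> B i}) J"
          unfolding disjoint_family_on_def using B_inj[OF subsetD[OF J] subsetD[OF J]] by auto
      qed (use finite_subset[OF J finI] in auto)
      moreover have "(\<Union>i\<in>J. {x \<in> space M. g n x \<in> B i}) = {x \<in> space M. g n x \<in> (\<Union>i\<in>J. B i)}" by blast
      ultimately show ?thesis by simp
    qed
    then show ?thesis
      by (simp add: w_def sum.swap[of _ _ J] flip: sum_divide_distrib)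
  qed
  have "\<exists>J\<subseteq>I. sum w J \<le> prob (\<Union>i\<in>J. H i) \<and> real T * prob (G k - (\<Union>i\<in>J. H i)) \<le> sum w I"
  proof (rule greedy_cover[OF finI])
    fix x assume x: "x \<in> G k"
    \<comment> \<open>A separating index \<open>l < k\<close> lies in exactly one of two
      codes.\<close>
    have "inj_on (\<lambda>n. code (g n x)) {..<T}"
      using x by (auto simp: G_def inj_on_def code_def set_eq_iff)
    moreover have "(\<lambda>n. code (g n x)) ` {..<T} \<subseteq> {i \<in> I. x \<in> H i}"
      using x code_I code_B by (auto simp: H_def G_def)
    ultimately have "card {..<T} \<le> card {i \<in> I. x \<in> H i}"
      using finI by (intro card_inj_on_le) auto
    then show "T \<le> card {i \<in> I. x \<in> H i}" by simp
  next
    show "H i \<in> events" for i unfolding H_def by measurable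
    show "w i \<ge> 0" for i using e by (auto simp: w_def intro!: divide_nonneg_nonneg sum_nonneg)
  qed (rule G)
  then obtain J where J: "J \<subseteq> I" "sum w J \<le> prob (\<Union>i\<in>J. H i)"
    "real T * prob (G k - (\<Union>i\<in>J. H i)) \<le> sum w I" by blast
  define A where "A = (\<Union>i\<in>J. B i)"
  have A[measurable]: "A \<in> sets borel"
    unfolding A_def using finite_subset[OF J(1) finI] by (intro sets.finite_UN) auto
  show ?thesis
  proof (intro bexI[OF _ A] exI[of _ T] conjI T(1))
    have "sum w J \<le> 1" using J(2) prob_le_1 order_trans by blast
    then show "(\<Sum>n<N. prob {x \<in> space M. g n x \<in> A}) \<le> e"
      using sum_w[OF J(1)] e by (simp add: A_def field_simps)
    have "(\<Union>i\<in>I. B i) = UNIV" using code_B code_I by blast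
    then have "sum w I = N / e" using sum_w[of I] by (simp add: prob_space)
    then have "real T * prob (G k - (\<Union>i\<in>J. H i)) \<le> real N / e" using J(3) by simp
    also have "\<dots> = (2 * real N / e\<^sup>2) * (e / 2)" using e by (simp add: power2_eq_square)
    also have "\<dots> \<le> real T * (e / 2)" using T(3) e by (intro mult_right_mono) auto
    finally have 1: "prob (G k - (\<Union>i\<in>J. H i)) \<le> e / 2" using T(2) by simp
    define V where "V = (\<Union>i\<in>J. H i)"
    have V[measurable]: "V \<in> events"
      unfolding V_def H_def using finite_subset[OF J(1) finI] by (intro sets.finite_UN) auto
    have "prob {x \<in> space M. \<forall>n<T. g n x \<notin> A} \<le> prob ((G k - V) \<union> (space M - G k))"
    proof (rule finite_measure_mono)
      show "{x \<in> space M. \<forall>n<T. g n x \<notin> A} \<subseteq> (G k - V) \<union> (space M - G k)"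
        by (auto simp: A_def H_def V_def)
    qed measurable
    also have "\<dots> \<le> prob (G k - V) + prob (space M - G k)"
      by (intro measure_Un_le) auto
    also have "\<dots> \<le> e" using 1 k prob_compl[OF G[of k]] by (simp add: V_def)
    finally show "prob {x \<in> space M. \<forall>n<T. g n x \<notin> A} \<le> e" .
  qed
qed

section \<open>Disjoint Borel classes by Borel--Cantelli\<close>

text \<open>The \<open>g n\<close> are general random points rather than translations, so that
  \<open>M\<close> may be a product whose first coordinate selects a translate.\<close>

lemma (in prob_space) AE_infinitely_often_disjoint_family:
  fixes g :: "nat \<Rightarrow> 'a \<Rightarrow> 'b::{second_countable_topology, t1_space}"
  assumes g[measurable]: "\<And>n. g n \<in> borel_measurable M"
    and inj: "\<And>x. x \<in> space M \<Longrightarrow> inj (\<lambda>n. g n x)"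
  shows "\<exists>D :: nat \<Rightarrow> 'b set. range D \<subseteq> sets borel \<and> disjoint_family D \<and>
    (AE x in M. \<forall>j. infinite {n. g n x \<in> D j})"
proof -
  \<comment> \<open>The step from \<open>(A, N)\<close> to \<open>(A', N')\<close> chooses a set
    rarely hit before the old bound and rarely missed before the new one; the errors
    \<open>(1/2)^m\<close> are summable.\<close>
  let ?P = "\<lambda>m (A, N) (A', N'). N \<le> N' \<and> (\<Sum>n<N. prob {x \<in> space M. g n x \<in> A'}) \<le> (1/2)^m \<and>
      prob {x \<in> space M. \<forall>n<N'. g n x \<notin> A'} \<le> (1/2)^m"
  have "\<exists>f. \<forall>m. fst (f m) \<in> sets borel \<and> ?P m (f m) (f (Suc m))"
  proof (rule dependent_nat_choice)
    show "\<exists>p :: 'b set \<times> nat. fst p \<in> sets borel" by (intro exI[of _ "({}, 0)"]) simp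
    fix p :: "'b set \<times> nat" and m :: nat
    have "(1/2 :: real) ^ m > 0" by simp
    from small_hitting_set[of g, OF g inj this, of "snd p"]
    show "\<exists>p'. fst p' \<in> sets borel \<and> ?P m p p'" by (auto simp: case_prod_beta)
  qed
  then obtain f where "\<forall>m. fst (f m) \<in> sets borel \<and> ?P m (f m) (f (Suc m))" ..
  then have f: "fst (f m) \<in> sets borel" "?P m (f m) (f (Suc m))" for m by simp_all
  \<comment> \<open>The set chosen in step \<open>m\<close> sits in state \<open>Suc m\<close>; the
    shift pairs \<open>A m\<close> with the bounds \<open>N m\<close> and
    \<open>N (Suc m)\<close>.\<close>
  define A where "A m = fst (f (Suc m))" for m
  define N where "N m = snd (f m)" for m
  have A[measurable]: "A m \<in> sets borel" for m by (simp add: A_def f)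
  have N: "N m \<le> N (Suc m)"
    and early: "(\<Sum>n<N m. prob {x \<in> space M. g n x \<in> A m}) \<le> (1/2)^m"
    and hit: "prob {x \<in> space M. \<forall>n<N (Suc m). g n x \<notin> A m} \<le> (1/2)^m" for m
    using f(2)[of m] by (auto simp: A_def N_def case_prod_beta)
  have N_mono: "N m \<le> N m'" if "m \<le> m'" for m m'
    using lift_Suc_mono_le[of N, OF N that] .

  have borel_cantelli: "AE x in M. eventually (\<lambda>m. x \<notin> C m) sequentially"
    if [measurable]: "\<And>m. C m \<in> events" and C: "\<And>m. prob (C m) \<le> (1/2)^m" for C :: "nat \<Rightarrow> 'a set"
  proof -
    have "summable (\<lambda>m. prob (C m))"
      using C by (intro summable_comparison_test[OF _ summable_geometric[of "1/2 :: real"]]) auto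
    then have "AE x in M. eventually (\<lambda>m. x \<in> space M - C m) sequentially"
      by (intro borel_cantelli_AE1) (auto simp: emeasure_eq_measure)
    then show ?thesis by (auto elim: eventually_mono)
  qed
  have "AE x in M. eventually (\<lambda>m. x \<notin> {x \<in> space M. \<forall>n<N (Suc m). g n x \<notin> A m}) sequentially"
    using hit by (intro borel_cantelli) auto
  moreover have "AE x in M. eventually (\<lambda>m. x \<notin> {x \<in> space M. \<exists>n<N m. g n x \<in> A m}) sequentially"
  proof (rule borel_cantelli)
    fix m
    have "{x \<in> space M. \<exists>n<N m. g n x \<in> A m} = (\<Union>n\<in>{..<N m}. {x \<in> space M. g n x \<in> A m})" by blast
    also have "prob \<dots> \<le> (\<Sum>n<N m. prob {x \<in> space M. g n x \<in> A m})"
      by (intro finite_measure_subadditive_finite) auto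
    finally show "prob {x \<in> space M. \<exists>n<N m. g n x \<in> A m} \<le> (1/2)^m" using early[of m] by simp
  qed measurable
  moreover note AE_space
  ultimately have ae: "AE x in M. eventually (\<lambda>m. (\<exists>n<N (Suc m). g n x \<in> A m) \<and> (\<forall>n<N m. g n x \<notin> A m)) sequentially"
    by eventually_elim (auto elim: eventually_elim2)

  define last where "last m = A m - (\<Union>m'\<in>{m<..}. A m')" for m
  have [measurable]: "last m \<in> sets borel" for m unfolding last_def by measurable
  have last_unique: "m = m'" if "y \<in> last m" "y \<in> last m'" for m m' y
    using that by (cases m m' rule: linorder_cases) (auto simp: last_def)
  \<comment> \<open>The pairing function gives every colour to infinitely many
    \<open>m\<close>.\<close>
  define colour where "colour m = fst (prod_decode m)" for m
  define D where "D j = (\<Union>m\<in>{m. colour m = j}. last m)" for j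
  show ?thesis
  proof (intro exI[of _ D] conjI)
    show "range D \<subseteq> sets borel" unfolding D_def by auto
    show "disjoint_family D" unfolding disjoint_family_on_def D_def using last_unique by blast
    show "AE x in M. \<forall>j. infinite {n. g n x \<in> D j}"
      using ae
    proof eventually_elim
      case (elim x)
      then obtain m0 where m0: "\<And>m. m \<ge> m0 \<Longrightarrow> \<exists>n<N (Suc m). g n x \<in> A m"
          "\<And>m n. m \<ge> m0 \<Longrightarrow> n < N m \<Longrightarrow> g n x \<notin> A m"
        unfolding eventually_sequentially by blast
      have "\<exists>n. g n x \<in> last m" if m: "m \<ge> m0" for m
      proof -
        obtain n where n: "n < N (Suc m)" "g n x \<in> A m" using m0(1)[OF m] by blast
        \<comment> \<open>Since \<open>n < N (Suc m) \<le> N m'\<close>, the index counts as early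
          for every later stage, so \<open>A m'\<close> misses the point.\<close>
        have "g n x \<notin> A m'" if "m' > m" for m'
          using m0(2)[of m' n] n(1) N_mono[of "Suc m" m'] that m by auto
        then show ?thesis using n(2) by (auto simp: last_def)
      qed
      then obtain n where n: "\<And>m. m \<ge> m0 \<Longrightarrow> g (n m) x \<in> last m" by metis
      show ?case
      proof
        fix j
        define K where "K = {m. colour m = j} - {..<m0}"
        have "infinite {m. colour m = j}"
        proof -
          have "(\<lambda>i. prod_encode (j, i)) ` UNIV \<subseteq> {m. colour m = j}" by (auto simp: colour_def)
          moreover have "inj (\<lambda>i. prod_encode (j, i))" by (auto simp: inj_def)
          ultimately show ?thesis by (meson finite_imageD finite_subset infinite_UNIV_nat)
        qed
        then have "infinite K" by (simp add: K_def)
        moreover have "inj_on n K"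
        proof (rule inj_onI)
          fix m m' assume "m \<in> K" "m' \<in> K" "n m = n m'"
          then show "m = m'" using n[of m] n[of m'] last_unique by (auto simp: K_def)
        qed
        moreover have "n ` K \<subseteq> {n. g n x \<in> D j}" using n by (auto simp: K_def D_def)
        ultimately show "infinite {n. g n x \<in> D j}" by (meson finite_imageD finite_subset)
      qed
    qed
  qed
qed

section \<open>Colourings obtained by choice\<close>

text \<open>Only finitely many values are excluded when \<open>h k\<close> is picked after all
  \<open>h i\<close> with \<open>i < k\<close>.\<close>

lemma distinct_representatives:
  fixes F :: "nat \<Rightarrow> 'b set"
  assumes "\<And>k. infinite (F k)"
  obtains h where "inj h" "\<And>k. h k \<in> F k"
proof -
  have "\<exists>h. \<forall>k. h k \<in> F k - h ` {..<k}"
  proof (rule dependent_wf_choice[OF wf_less_than])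
    fix f g :: "nat \<Rightarrow> 'b" and k y
    assume "\<And>z. (z, k) \<in> less_than \<Longrightarrow> f z = g z"
    then have "f ` {..<k} = g ` {..<k}" by (intro image_cong) auto
    then show "y \<in> F k - f ` {..<k} \<longleftrightarrow> y \<in> F k - g ` {..<k}" by simp
  next
    fix k and f :: "nat \<Rightarrow> 'b"
    have "infinite (F k - f ` {..<k})" using assms by simp
    then show "\<exists>y. y \<in> F k - f ` {..<k}" by (metis equals0I finite.emptyI)
  qed
  then obtain h where h: "\<And>k. h k \<in> F k - h ` {..<k}" by blast
  have "h i \<noteq> h j" if "i < j" for i j
    using h[of j] that by (metis DiffD2 imageI lessThan_iff)
  then have "inj h" by (metis injI linorder_neqE_nat)
  then show thesis using h that by blast
qed

text \<open>Each pair of an \<open>x\<close> and a colour \<open>j\<close> is a request; distinct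
  representatives give every request its own point of \<open>F x\<close>, which can be coloured
  \<open>j\<close> without conflict.\<close>

lemma colouring_countable_family:
  assumes "countable X" and "\<And>x. x \<in> X \<Longrightarrow> infinite (F x)"
  shows "\<exists>f :: 'b \<Rightarrow> nat. \<forall>x\<in>X. \<forall>j. \<exists>y\<in>F x. f y = j"
proof (cases "X = {}")
  case False
  define e where "e k = from_nat_into X (fst (prod_decode k))" for k
  have "infinite (F (e k))" for k
    using False assms(2) by (simp add: e_def from_nat_into)
  then obtain h where h: "inj h" "\<And>k. h k \<in> F (e k)" using distinct_representatives[of "\<lambda>k. F (e k)"] by blast
  show ?thesis
  proof (intro exI ballI allI)
    fix x j assume "x \<in> X"
    then obtain i where "from_nat_into X i = x" using assms(1) from_nat_into_surj by metis
    then have "h (prod_encode (i, j)) \<in> F x" using h(2)[of "prod_encode (i, j)"] by (simp add: e_def)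
    \<comment> \<open>\<open>inv h\<close> recovers the request that a point serves; points outside
      the range of \<open>h\<close> get an arbitrary colour.\<close>
    moreover have "(\<lambda>y. snd (prod_decode (inv h y))) (h (prod_encode (i, j))) = j" using h(1) by simp
    ultimately show "\<exists>y\<in>F x. (\<lambda>y. snd (prod_decode (inv h y))) y = j" by blast
  qed
qed simp

text \<open>Components of the underlying undirected graph are countable and contain the
  out-neighbours of their vertices, so separate colourings of them fit together.\<close>

lemma colouring_locally_countable:
  fixes E :: "('a \<times> 'a) set"
  assumes out: "\<And>x. countable (E `` {x})" and "in": "\<And>x. countable (E\<inverse> `` {x})"
  shows "\<exists>f :: 'a \<Rightarrow> nat. \<forall>x. infinite (E `` {x} \<inter> A) \<longrightarrow> (\<forall>j. \<exists>y\<in>E `` {x} \<inter> A. f y = j)"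
proof -
  define R where "R = (E \<union> E\<inverse>)\<^sup>*"
  have "countable ((E \<union> E\<inverse>) `` Y)" if "countable Y" for Y
  proof -
    have "(E \<union> E\<inverse>) `` Y = (\<Union>y\<in>Y. E `` {y} \<union> E\<inverse> `` {y})" by blast
    then show ?thesis by (simp only:) (intro countable_UN countable_Un that out "in")
  qed
  then have R: "countable (R `` {x})" for x
    unfolding R_def by (intro countable_rtrancl) auto
  have "\<exists>f :: 'a \<Rightarrow> nat. \<forall>x\<in>{x \<in> R `` {c}. infinite (E `` {x} \<inter> A)}. \<forall>j. \<exists>y\<in>E `` {x} \<inter> A. f y = j" for c
    by (rule colouring_countable_family) (auto intro: countable_subset[OF _ R[of c]])
  \<comment> \<open>Choosing per component as a set, not per base point, makes all its vertices
    share one colouring.\<close>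
  then have "\<forall>C\<in>range (\<lambda>c. R `` {c}). \<exists>f :: 'a \<Rightarrow> nat.
      \<forall>x\<in>{x \<in> C. infinite (E `` {x} \<inter> A)}. \<forall>j. \<exists>y\<in>E `` {x} \<inter> A. f y = j"
    by (intro ballI) (elim rangeE, simp only:)
  from bchoice[OF this] obtain f :: "'a set \<Rightarrow> 'a \<Rightarrow> nat" where "\<forall>C\<in>range (\<lambda>c. R `` {c}).
      \<forall>x\<in>{x \<in> C. infinite (E `` {x} \<inter> A)}. \<forall>j. \<exists>y\<in>E `` {x} \<inter> A. f C y = j" ..
  then have f: "\<exists>y\<in>E `` {x} \<inter> A. f (R `` {c}) y = j"
    if "x \<in> R `` {c}" "infinite (E `` {x} \<inter> A)" for c x j
    using that by simp
  have eq: "R `` {y} = R `` {x}" if "(x, y) \<in> E" for x y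
  proof -
    have "(x, y) \<in> R" "(y, x) \<in> R" using that by (auto simp: R_def)
    then show ?thesis unfolding R_def by (auto intro: rtrancl_trans)
  qed
  show ?thesis
  proof (intro exI[of _ "\<lambda>y. f (R `` {y}) y"] allI impI)
    fix x j assume "infinite (E `` {x} \<inter> A)"
    moreover have "x \<in> R `` {x}" by (simp add: R_def)
    ultimately obtain y where "y \<in> E `` {x} \<inter> A" "f (R `` {x}) y = j" using f by blast
    then show "\<exists>y\<in>E `` {x} \<inter> A. f (R `` {y}) y = j" using eq by (intro bexI[of _ y]) auto
  qed
qed

section \<open>Schreier graph: repair on a null set\<close>

theorem theorem1p3:
  fixes \<mu> :: "'a::{polish_space, topological_group_add} measure"
    and S :: "'a set"
  assumes "sets \<mu> = sets borel"
    and "prob_space \<mu>"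
    and "countable S"
    and "infinite S"
  shows "\<exists>D. measurable_domatic_partition \<mu> (schreier_graph S) D"
proof -
  interpret \<mu>: prob_space \<mu> by fact
  have [measurable_cong]: "sets \<mu> = sets borel" by fact
  have space: "space \<mu> = UNIV" using sets_eq_imp_space_eq[OF assms(1)] by simp
  define s where "s = from_nat_into S"
  have s: "inj s" "range s = S"
    using bij_betw_from_nat_into[OF assms(3,4)] by (auto simp: s_def bij_betw_def)
  let ?p = "measure_pmf (geometric_pmf (1/2))"
  interpret p: pair_prob_space ?p \<mu> ..
  txt \<open>The product with the geometric distribution, which gives every \<open>m\<close> positive mass, handles all
    the translates of \<open>\<mu>\<close> at once.\<close>
  define g where "g n = (\<lambda>(m, y). s n + (- s m + y))" for n
  have "(\<lambda>y. s n + (- s m + y)) \<in> borel_measurable borel" for n m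
    by (intro borel_measurable_continuous_onI continuous_intros)
  then have g: "g n \<in> borel_measurable (?p \<Otimes>\<^sub>M \<mu>)" for n
    unfolding g_def by measurable
  have "inj (\<lambda>n. g n x)" for x
    using s(1) by (auto simp: g_def inj_def split: prod.splits)
  then obtain D :: "nat \<Rightarrow> 'a set" where D: "range D \<subseteq> sets borel" "disjoint_family D"
    and ae: "AE x in ?p \<Otimes>\<^sub>M \<mu>. \<forall>j. infinite {n. g n x \<in> D j}"
    using p.AE_infinitely_often_disjoint_family[of g] g by blast
  define B where "B = {x. \<exists>j. finite {n. s n + x \<in> D j}}"
  \<comment> \<open>This is \<open>S + B\<close>, since \<open>y = s m + x\<close> amounts to
    \<open>- s m + y = x\<close>.\<close>
  define A where "A = {y. \<exists>m. - s m + y \<in> B}"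
  have "AE m in ?p. AE y in \<mu>. - s m + y \<notin> B"
    using p.AE_pair[OF ae] by (simp add: g_def B_def)
  then have "AE y in \<mu>. - s m + y \<notin> B" for m
    by (simp add: AE_measure_pmf_iff set_pmf_geometric)
  then have "AE y in \<mu>. y \<notin> A" by (simp add: A_def AE_all_countable)
  then obtain N where N: "N \<in> null_sets \<mu>" "A \<subseteq> N" by (auto simp: space eventually_ae_filter)
  \<comment> \<open>Subsets of a null set are measurable in the completion, so a colouring of
    \<open>A\<close> made by choice is harmless.\<close>
  have sub_A: "C \<in> sets (completion \<mu>)" if "C \<subseteq> A" for C
    using null_sets_completion[OF N(1)] that N(2) by blast

  let ?E = "schreier_graph S"
  have out: "?E `` {x} = range (\<lambda>n. s n + x)" for x
    using s(2) by (auto simp: schreier_graph_out_neighbourhood)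
  have "countable (?E\<inverse> `` {x})" for x
  proof -
    have "?E\<inverse> `` {x} \<subseteq> (\<lambda>t. - t + x) ` S"
      by (auto simp: schreier_graph_def image_iff) (metis minus_add_cancel)
    then show ?thesis using assms(3) countable_subset by blast
  qed
  moreover have "countable (?E `` {x})" for x by (simp add: out)
  ultimately obtain f :: "'a \<Rightarrow> nat"
    where f: "\<And>x j. infinite (?E `` {x} \<inter> A) \<Longrightarrow> \<exists>y\<in>?E `` {x} \<inter> A. f y = j"
    using colouring_locally_countable[of ?E A] by blast
  have inj_out: "inj (\<lambda>n. s n + x)" for x using s(1) by (auto simp: inj_def)

  define D' where "D' j = (D j - A) \<union> {y \<in> A. f y = j}" for j
  have "measurable_domatic_partition \<mu> ?E D'"
    unfolding measurable_domatic_partition_def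
  proof (intro conjI allI)
    show "D' j \<in> sets (completion \<mu>)" for j
      unfolding D'_def using D(1) assms(1) by (intro sets.Un sets.Diff sub_A sets_completionI_sets) auto
    show "disjoint_family D'" using D(2) unfolding disjoint_family_on_def D'_def by blast
    fix x j
    show "?E `` {x} \<inter> D' j \<noteq> {}"
    proof (cases "finite (?E `` {x} \<inter> A)")
      case False
      then show ?thesis using f[of x j] by (auto simp: D'_def)
    next
      case True
      \<comment> \<open>A bad \<open>x\<close> would have its whole infinite out-neighbourhood in
        \<open>A\<close>.\<close>
      have "x \<notin> B"
      proof
        assume "x \<in> B"
        then have "- s n + (s n + x) \<in> B" for n by simp
        then have "?E `` {x} \<subseteq> A" unfolding A_def out by blast
        then have "finite (range (\<lambda>n. s n + x))" using True by (simp add: out Int_absorb2)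
        then show False using inj_out finite_imageD infinite_UNIV_nat by blast
      qed
      then have "infinite {n. s n + x \<in> D j}" by (simp add: B_def)
      moreover have "finite ((\<lambda>n. s n + x) -` (?E `` {x} \<inter> A))"
        by (rule finite_vimageI[OF True inj_out])
      ultimately obtain n where "s n + x \<in> D j" "n \<notin> (\<lambda>n. s n + x) -` (?E `` {x} \<inter> A)"
        by (metis (no_types, lifting) finite_subset mem_Collect_eq subsetI)
      then have "s n + x \<in> ?E `` {x} \<inter> D' j" by (auto simp: D'_def out)
      then show ?thesis by blast
    qed
  qed
  then show ?thesis by blast
qed

end
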